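(* There exist four vectors $v_1,v_2,v_3,v_4\in\mathbb{R}^2$ such that the additive subgroup $\mathcal{A}=\langle v_1,v_2,v_3,v_4\rangle_{\mathbb{Z}}$ of $\mathbb{R}^2$ has infinitely many elements on the unit circle, i.e. the set $\{v\in\mathcal{A} : \|v\|=1\}$ is infinite, where $\|\cdot\|$ is the Euclidean norm.
   Context: For vectors $v_1,\dots,v_n\in\mathbb{R}^2$, the notation $\langle v_1,\dots,v_n\rangle_{\mathbb{Z}}$ means $\{a_1v_1+\dots+a_nv_n : a_1,\dots,a_n\in\mathbb{Z}\}$. The unit circle is the set of vectors of Euclidean norm $1$ in $\mathbb{R}^2$, centred at the origin. *)

theory Defs
  imports "HOL-Analysis.Analysis"
begin

definition int_span :: "'a::real_vector list \<Rightarrow> 'a set" where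
  "int_span vs = {(\<Sum>i<length vs. of_int (a i) *\<^sub>R vs ! i) | a :: nat \<Rightarrow> int. True}"

end

theory Submission
  imports Defs "HOL-Computational_Algebra.Primes"
begin

text \<open>Put \<open>y = 1 - sqrt 2\<close> and \<open>\<theta> = arccos (y / 2)\<close>. Then \<open>z = exp (i \<theta>)\<close> satisfies
  \<open>z\<^sup>2 = y z - 1\<close>, so \<open>\<int>[sqrt 2] + \<int>[sqrt 2] z\<close> is a group of rank four containing every power of
  \<open>z\<close>. These powers are distinct: the numbers \<open>2 cos (n \<theta>)\<close> lie in \<open>\<int>[sqrt 2]\<close>, and their
  conjugates satisfy the same recurrence with \<open>1 + sqrt 2 > 2\<close> in place of \<open>y\<close>, hence strictly
  increase. (In other words, \<open>z\<close> is a conjugate of a Salem number of degree four.)\<close>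

text \<open>A pair \<open>(p, q)\<close> encodes \<open>p + q * sqrt 2\<close>, which makes
  conjugation a mere sign change. The last equation is \<open>x'' = (1 - sqrt 2) * x' - x\<close>
  expanded by means of \<open>(sqrt 2)^2 = 2\<close>.\<close>

fun trace_coeffs :: "nat \<Rightarrow> int \<times> int" where
  "trace_coeffs 0 = (2, 0)"
| "trace_coeffs (Suc 0) = (1, - 1)"
| "trace_coeffs (Suc (Suc n)) =
    (let (p, q) = trace_coeffs n; (p', q') = trace_coeffs (Suc n)
     in (p' - 2 * q' - p, q' - p' - q))"

definition trace_val :: "nat \<Rightarrow> real" where
  "trace_val n = fst (trace_coeffs n) + snd (trace_coeffs n) * sqrt 2"

definition trace_conj :: "nat \<Rightarrow> real" where
  "trace_conj n = fst (trace_coeffs n) - snd (trace_coeffs n) * sqrt 2"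

lemma trace_val_rec:
  "trace_val (Suc (Suc n)) = (1 - sqrt 2) * trace_val (Suc n) - trace_val n"
  by (simp add: trace_val_def case_prod_unfold Let_def algebra_simps)

lemma trace_conj_rec:
  "trace_conj (Suc (Suc n)) = (1 + sqrt 2) * trace_conj (Suc n) - trace_conj n"
  by (simp add: trace_conj_def case_prod_unfold Let_def algebra_simps)

text \<open>Since \<open>1 + sqrt 2 > 2\<close>, the recurrence gives
  \<open>x'' - x' > x' - x\<close> as long as \<open>x' > 0\<close>, so the increments stay
  positive.\<close>

lemma trace_conj_strict_mono: "strict_mono trace_conj"
proof -
  \<comment> \<open>The bound 2, attained at \<open>n = 0\<close>, supplies the positivity for
    multiplying by \<open>1 + sqrt 2\<close>.\<close>
  have "2 \<le> trace_conj n \<and> trace_conj n < trace_conj (Suc n)" for n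
  proof (induction n)
    case 0
    show ?case by (simp add: trace_conj_def)
  next
    case (Suc n)
    have "2 * trace_conj (Suc n) < (1 + sqrt 2) * trace_conj (Suc n)"
      using Suc by (intro mult_strict_right_mono) auto
    with Suc show ?case unfolding trace_conj_rec by linarith
  qed
  then show ?thesis by (simp add: strict_mono_Suc_iff)
qed

text \<open>Irrationality of \<open>sqrt 2\<close>: in \<open>a^2 = 2 * b^2\<close> the exponent of
  2 would be even on the left and odd on the right.\<close>

lemma int_sqrt2_eq_0_iff:
  fixes a b :: int
  shows "a + b * sqrt 2 = 0 \<longleftrightarrow> a = 0 \<and> b = 0"
proof
  assume *: "a + b * sqrt 2 = 0"
  have "b = 0"
  proof (rule ccontr)
    assume "b \<noteq> 0"
    have "real_of_int a = - (b * sqrt 2)" using * by linarith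
    then have "real_of_int (a\<^sup>2) = (- (b * sqrt 2))\<^sup>2" by simp
    also have "\<dots> = real_of_int (2 * b\<^sup>2)" by (simp add: power_mult_distrib)
    finally have eq: "a\<^sup>2 = 2 * b\<^sup>2" by linarith
    then have "multiplicity 2 (a\<^sup>2) = multiplicity 2 (2 * b\<^sup>2)" by simp
    moreover have "a \<noteq> 0" using eq \<open>b \<noteq> 0\<close> by auto
    ultimately have "2 * multiplicity 2 a = Suc (2 * multiplicity 2 b)"
      using \<open>b \<noteq> 0\<close>
      by (simp add: prime_elem_multiplicity_mult_distrib prime_elem_multiplicity_power_distrib)
    then show False by presburger
  qed
  with * show "a = 0 \<and> b = 0" by simp
qed auto

text \<open>Equal values have equal coefficients, hence equal conjugates, and these strictly
  increase.\<close>

lemma trace_val_inj: "inj trace_val"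
proof (rule injI)
  fix m n assume "trace_val m = trace_val n"
  then have "real_of_int (fst (trace_coeffs m) - fst (trace_coeffs n))
      + real_of_int (snd (trace_coeffs m) - snd (trace_coeffs n)) * sqrt 2 = 0"
    by (simp add: trace_val_def algebra_simps)
  then have "trace_coeffs m = trace_coeffs n"
    unfolding int_sqrt2_eq_0_iff by (simp add: prod_eq_iff)
  then have "trace_conj m = trace_conj n" by (simp add: trace_conj_def)
  then show "m = n" using trace_conj_strict_mono by (simp add: strict_mono_eq)
qed

definition circle_point :: "real \<Rightarrow> real ^ 2" where
  "circle_point t = vector [cos t, sin t]"

lemma norm_circle_point: "norm (circle_point t) = 1"
  by (simp add: circle_point_def norm_vec_def L2_set_def sum_2)

text \<open>In complex terms, with \<open>w = exp (i s)\<close>, this is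
  \<open>w^2 = (2 * cos s) * w - 1\<close> multiplied by \<open>exp (i t)\<close>.\<close>

lemma circle_point_rec:
  "circle_point (t + 2 * s) = (2 * cos s) *\<^sub>R circle_point (t + s) - circle_point t"
proof -
  have "cos (t + 2 * s) = 2 * cos s * cos (t + s) - cos t"
    "sin (t + 2 * s) = 2 * cos s * sin (t + s) - sin t"
    using cos_add[of "t + s" s] cos_diff[of "t + s" s] sin_add[of "t + s" s] sin_diff[of "t + s" s]
    by (simp_all add: algebra_simps)
  then show ?thesis
    by (simp add: circle_point_def vec_eq_iff forall_2)
qed

lemma mem_int_span4:
  "x \<in> int_span [v1, v2, v3, v4] \<longleftrightarrow>
    (\<exists>a b c d :: int. x = of_int a *\<^sub>R v1 + of_int b *\<^sub>R v2 + of_int c *\<^sub>R v3 + of_int d *\<^sub>R v4)"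
proof
  show "x \<in> int_span [v1, v2, v3, v4]"
    if "\<exists>a b c d :: int. x = of_int a *\<^sub>R v1 + of_int b *\<^sub>R v2 + of_int c *\<^sub>R v3 + of_int d *\<^sub>R v4"
  proof -
    from that obtain a b c d :: int
      where x: "x = of_int a *\<^sub>R v1 + of_int b *\<^sub>R v2 + of_int c *\<^sub>R v3 + of_int d *\<^sub>R v4" by blast
    show ?thesis
      unfolding int_span_def
      by (rule CollectI, rule exI[of _ "\<lambda>i. [a, b, c, d] ! i"]) (simp add: x eval_nat_numeral)
  qed
qed (auto simp: int_span_def eval_nat_numeral)

definition salem_angle :: real where
  "salem_angle = arccos ((1 - sqrt 2) / 2)"

lemma cos_salem_angle: "2 * cos salem_angle = 1 - sqrt 2"
proof -
  have "\<bar>(1 - sqrt 2) / 2\<bar> \<le> 1"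
    using sqrt2_less_2 by (simp add: abs_if)
  then show ?thesis by (simp only: salem_angle_def cos_arccos_abs) simp
qed

text \<open>Both sides start with 2 and \<open>1 - sqrt 2\<close> and obey the same recurrence; for
  the cosines it is the first coordinate of \<open>circle_point_rec\<close>.\<close>

lemma trace_val_eq_cos: "trace_val n = 2 * cos (n * salem_angle)"
proof (induction n rule: induct_nat_012)
  case (ge2 n)
  have "2 * cos (n * salem_angle + 2 * salem_angle)
      = (1 - sqrt 2) * (2 * cos (n * salem_angle + salem_angle)) - 2 * cos (n * salem_angle)"
    using arg_cong[OF circle_point_rec[of "n * salem_angle" salem_angle], of "\<lambda>v. 2 * v $ 1"]
    by (simp add: circle_point_def cos_salem_angle right_diff_distrib)
  with ge2 show ?case
    by (simp add: trace_val_rec algebra_simps)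
qed (use cos_salem_angle in \<open>simp_all add: trace_val_def\<close>)

text \<open>The span is a module over \<int>[\<open>sqrt 2\<close>], so it is closed under
  multiplication by \<open>1 - sqrt 2\<close> and the recurrence never leaves it.\<close>

lemma circle_point_mem_int_span:
  fixes n :: nat
  defines "e \<equiv> circle_point 0" and "z \<equiv> circle_point salem_angle"
  shows "circle_point (n * salem_angle) \<in> int_span [e, sqrt 2 *\<^sub>R e, z, sqrt 2 *\<^sub>R z]"
proof (induction n rule: induct_nat_012)
  case 0
  have "circle_point (0 * salem_angle)
      = of_int 1 *\<^sub>R e + of_int 0 *\<^sub>R sqrt 2 *\<^sub>R e + of_int 0 *\<^sub>R z + of_int 0 *\<^sub>R sqrt 2 *\<^sub>R z"
    by (simp add: e_def)
  then show ?case unfolding mem_int_span4 of_nat_0 by blast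
next
  case 1
  have "circle_point (Suc 0 * salem_angle)
      = of_int 0 *\<^sub>R e + of_int 0 *\<^sub>R sqrt 2 *\<^sub>R e + of_int 1 *\<^sub>R z + of_int 0 *\<^sub>R sqrt 2 *\<^sub>R z"
    by (simp add: z_def)
  then show ?case unfolding mem_int_span4 by blast
next
  case (ge2 n)
  then obtain a b c d a' b' c' d' :: int where
    x: "circle_point (n * salem_angle)
      = of_int a *\<^sub>R e + of_int b *\<^sub>R sqrt 2 *\<^sub>R e + of_int c *\<^sub>R z + of_int d *\<^sub>R sqrt 2 *\<^sub>R z" and
    y: "circle_point (Suc n * salem_angle)
      = of_int a' *\<^sub>R e + of_int b' *\<^sub>R sqrt 2 *\<^sub>R e + of_int c' *\<^sub>R z + of_int d' *\<^sub>R sqrt 2 *\<^sub>R z"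
    unfolding mem_int_span4 by blast
  have "circle_point (Suc (Suc n) * salem_angle)
      = (1 - sqrt 2) *\<^sub>R circle_point (Suc n * salem_angle) - circle_point (n * salem_angle)"
    using circle_point_rec[of "n * salem_angle" salem_angle] unfolding cos_salem_angle
    by (simp add: algebra_simps)
  \<comment> \<open>On \<open>e\<close> and on \<open>z\<close> alike, the new coefficients follow
    the rule of \<open>trace_coeffs\<close>.\<close>
  also have "\<dots> = of_int (a' - 2 * b' - a) *\<^sub>R e + of_int (b' - a' - b) *\<^sub>R sqrt 2 *\<^sub>R e
      + of_int (c' - 2 * d' - c) *\<^sub>R z + of_int (d' - c' - d) *\<^sub>R sqrt 2 *\<^sub>R z"
  proof -
    have "sqrt 2 * (sqrt 2 * r) = 2 * r" for r :: real by (simp flip: mult.assoc)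
    then show ?thesis unfolding x y by (simp add: algebra_simps)
  qed
  finally show ?case unfolding mem_int_span4 by blast
qed

theorem theorem1:
  shows "\<exists>v1 v2 v3 v4 :: real ^ 2.
    infinite {v \<in> int_span [v1, v2, v3, v4]. norm v = 1}"
proof -
  let ?e = "circle_point 0" and ?z = "circle_point salem_angle"
  let ?f = "\<lambda>n::nat. circle_point (n * salem_angle)"
  \<comment> \<open>First coordinates already separate the points: twice the first coordinate of
    \<open>?f n\<close> is \<open>trace_val n\<close>.\<close>
  have "inj ?f"
  proof (rule injI)
    fix m n assume "?f m = ?f n"
    then have "?f m $ 1 = ?f n $ 1" by simp
    then have "trace_val m = trace_val n" by (simp add: circle_point_def trace_val_eq_cos)
    then show "m = n" by (rule injD[OF trace_val_inj])
  qed
  then have "infinite (range ?f)" by (rule range_inj_infinite)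
  moreover have "range ?f \<subseteq> {v \<in> int_span [?e, sqrt 2 *\<^sub>R ?e, ?z, sqrt 2 *\<^sub>R ?z]. norm v = 1}"
    using circle_point_mem_int_span norm_circle_point by blast
  ultimately show ?thesis using infinite_super by blast
qed

end
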